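(* Let $A\in\mathbb{R}^{n\times n}$ be diagonalizable, with eigenbasis $\{u_j\}_{j=1}^n$, $Au_j=\lambda_ju_j$, $\|u_j\|=1$, and consider one of its eigenvectors $u_i\in\mathbb{R}^n$ for some $i\in\{1,\dots,n\}$. Let $v_1\in\mathbb{R}^n$ be the initial vector of the Krylov subspace $\mathcal{K}_k=\mathrm{span}\{v_1,Av_1,\dots,A^{k-1}v_1\}$, and suppose that $v_1=\sum_{j=1}^n\alpha_ju_j$ with $\alpha_i\ne0$. If $\Omega\in\mathbb{R}^{d\times n}$ is an $\epsilon$-embedding for $\mathrm{span}\{\mathcal{K}_k,u_i\}$, then $$\|(I-P^\Omega_{\mathcal{K}_k})u_i\|\le\sqrt{\frac{1+\epsilon}{1-\epsilon}}\;\xi_i\,\gamma_i^{(k)},$$ where $$\xi_i=\sum_{j=1,\,j\ne i}^n\frac{|\alpha_j|}{|\alpha_i|},\qquad \gamma_i^{(k)}=\min_{q\in\mathbb{P}^*_{k-1}}\ \max_{\lambda\in\Lambda(A)-\lambda_i}|q(\lambda)|,$$ and $\mathbb{P}^*_{k-1}$ is the set of all polynomials $q$ of degree at most $k-1$ such that $q(\lambda_i)=1$.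
   Context: Norms are Euclidean. $\Omega$ is an $\epsilon$-embedding for a subspace $\mathcal{S}\subset\mathbb{R}^n$ (with $\epsilon\in[0,1)$) if $(1-\epsilon)\|x\|^2\le\|\Omega x\|^2\le(1+\epsilon)\|x\|^2$ for all $x\in\mathcal{S}$. The projector $P^\Omega_{\mathcal{K}_k}$ onto $\mathcal{K}_k$ is defined by $P^\Omega_{\mathcal{K}_k}x=\arg\min_{y\in\mathcal{K}_k}\|\Omega(x-y)\|$ for $x\in\mathbb{R}^n$. The Krylov subspace $\mathcal{K}_k$ has dimension $k$. $\Lambda(A)-\lambda_i$ denotes the collection of the eigenvalues $\lambda_j$, $j\ne i$ (the spectrum counted with multiplicity, with one copy of $\lambda_i$ removed). The eigenvectors $u_j$ with $j\neq i$, the coefficients $\alpha_j$ and the polynomials may be complex. *)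

theory Defs
  imports "HOL-Analysis.Analysis" "HOL-Computational_Algebra.Polynomial"
begin

definition cvec :: "real ^ 'n \<Rightarrow> complex ^ 'n" where
  "cvec x = (\<chi> s. complex_of_real (x $ s))"

definition cmat :: "real ^ 'n ^ 'm \<Rightarrow> complex ^ 'n ^ 'm" where
  "cmat A = (\<chi> s t. complex_of_real (A $ s $ t))"

(* Linear independence and span are over the complex field (the locale prefix vec uses *s as scalar
   multiplication); the basis is indexed by 'n, so eigenvalues are listed with multiplicity. *)
definition unit_eigenbasis ::
    "real ^ 'n ^ 'n \<Rightarrow> ('n \<Rightarrow> complex ^ 'n) \<Rightarrow> ('n \<Rightarrow> complex) \<Rightarrow> bool" where
  "unit_eigenbasis A u lam \<longleftrightarrow>
     inj u \<and> vec.independent (range u) \<and> vec.span (range u) = UNIV \<and>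
     (\<forall>j. cmat A *v u j = lam j *s u j \<and> norm (u j) = 1)"

(* Iterated application is used because ^ is not the matrix power on real ^ 'n ^ 'n. *)
definition krylov :: "real ^ 'n ^ 'n \<Rightarrow> real ^ 'n \<Rightarrow> nat \<Rightarrow> (real ^ 'n) set" where
  "krylov A v k = span ((\<lambda>m. (((*v) A) ^^ m) v) ` {..<k})"

definition eps_embedding :: "real ^ 'n ^ 'd \<Rightarrow> real \<Rightarrow> (real ^ 'n) set \<Rightarrow> bool" where
  "eps_embedding \<Omega> \<epsilon> S \<longleftrightarrow>
     subspace S \<and> 0 \<le> \<epsilon> \<and> \<epsilon> < 1 \<and>
     (\<forall>x\<in>S. (1 - \<epsilon>) * (norm x)\<^sup>2 \<le> (norm (\<Omega> *v x))\<^sup>2 \<and>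
            (norm (\<Omega> *v x))\<^sup>2 \<le> (1 + \<epsilon>) * (norm x)\<^sup>2)"

(* The minimiser is unique whenever \<Omega> is injective on the subspace K, in particular when \<Omega> is an
   embedding for a subspace that contains K. *)
definition sketched_proj :: "real ^ 'n ^ 'd \<Rightarrow> (real ^ 'n) set \<Rightarrow> real ^ 'n \<Rightarrow> real ^ 'n" where
  "sketched_proj \<Omega> K x = arg_min_on (\<lambda>y. norm (\<Omega> *v (x - y))) K"

definition xi :: "('n::finite \<Rightarrow> complex) \<Rightarrow> 'n \<Rightarrow> real" where
  "xi \<alpha> i = (\<Sum>j\<in>UNIV - {i}. cmod (\<alpha> j) / cmod (\<alpha> i))"

definition normalized_polys :: "nat \<Rightarrow> complex \<Rightarrow> complex poly set" where
  "normalized_polys m z = {q. degree q \<le> m \<and> poly q z = 1}"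

(* LEAST is the minimum of the set of values, which is attained.  If CARD('n) = 1, no other
   eigenvalue exists and Max {} is an unspecified real; then xi is an empty sum, so that
   the product xi * gamma is 0 whatever this value is. *)
definition gamma_min :: "('n::finite \<Rightarrow> complex) \<Rightarrow> 'n \<Rightarrow> nat \<Rightarrow> real" where
  "gamma_min lam i k =
     (LEAST r. \<exists>q\<in>normalized_polys (k - 1) (lam i).
        r = Max ((\<lambda>z. cmod (poly q z)) ` (lam ` (UNIV - {i}))))"

end

theory Submission
  imports Defs
begin

text \<open>
  Two facts carry the proof. First, a sketched projection is quasi-optimal: the residual of the
  projection and the residual of any competitor both lie in the embedded space, so comparing their
  sketches costs only the two distortion factors (\<open>sketched_proj_quasi_optimal\<close>). Hence it
  suffices to exhibit one good element of the Krylov space.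

  Second, for a polynomial \<open>q\<close> of degree below \<open>k\<close> with \<open>q(\<lambda>\<^sub>i) = 1\<close>, the vector
  \<open>q(A) v\<^sub>1 / \<alpha>\<^sub>i\<close> equals \<open>u\<^sub>i\<close> plus the remainder
  \<open>\<Sum>\<^sub>j (\<alpha>\<^sub>j / \<alpha>\<^sub>i) q(\<lambda>\<^sub>j) u\<^sub>j\<close> over \<open>j \<noteq> i\<close>, whose norm is at most
  \<open>\<Sum>\<^sub>j |\<alpha>\<^sub>j| / |\<alpha>\<^sub>i| |q(\<lambda>\<^sub>j)|\<close>. This vector may be complex; but
  \<open>A\<close>, \<open>v\<^sub>1\<close> and \<open>u\<^sub>i\<close> are real, so its entrywise real part lies in the real Krylov space
  and is at least as close to \<open>u\<^sub>i\<close> (\<open>krylov_approximates_eigenvector\<close>).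

  Taking an optimal \<open>q\<close> gives the bound. Such a \<open>q\<close> exists because the vectors of
  eigenvalue values of admissible polynomials form a closed set, and minimising the maximum
  modulus over it can be confined to a compact part (\<open>best_normalized_poly\<close>).
\<close>

section \<open>Attainment of the polynomial minimax\<close>

lemma continuous_on_Max_image:
  fixes f :: "'i \<Rightarrow> 'a::topological_space \<Rightarrow> real"
  assumes "finite J" "J \<noteq> {}" "\<And>j. j \<in> J \<Longrightarrow> continuous_on S (f j)"
  shows "continuous_on S (\<lambda>x. Max ((\<lambda>j. f j x) ` J))"
  using assms
proof (induction J rule: finite_ne_induct)
  case (singleton j)
  then show ?case by simp
next
  case (insert j J)
  then have "continuous_on S (\<lambda>x. max (f j x) (Max ((\<lambda>j. f j x) ` J)))"
    by (intro continuous_on_max) auto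
  then show ?case using insert.hyps by simp
qed

text \<open>
  Instead of the polynomials themselves, which a seminorm on finitely many points does not bound,
  the argument works with their vectors of values at the eigenvalues. The constant polynomial 1
  has maximum 1, so only value vectors with entries of modulus at most 1 compete; these form a
  compact set, being the intersection of a linear subspace of a finite-dimensional space
  with bounded closed constraints.
\<close>

lemma best_normalized_poly:
  fixes lam :: "'n::finite \<Rightarrow> complex"
  assumes ne: "UNIV - {i} \<noteq> {}"
  obtains q where "q \<in> normalized_polys m (lam i)"
    and "\<And>p. p \<in> normalized_polys m (lam i) \<Longrightarrow>
      Max ((\<lambda>z. cmod (poly q z)) ` lam ` (UNIV - {i}))
        \<le> Max ((\<lambda>z. cmod (poly p z)) ` lam ` (UNIV - {i}))"
proof -
  define J where "J = UNIV - {i}"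
  define F where "F = (\<lambda>x::complex^'n. Max ((\<lambda>j. cmod (x $ j)) ` J))"
  define ev where "ev = (\<lambda>q. (\<chi> j. poly q (lam j)) :: complex^'n)"
  define W where "W = ev ` {q. degree q \<le> m}"
  define C where "C = W \<inter> {x. x $ i = 1 \<and> (\<forall>j. cmod (x $ j) \<le> 1)}"
  have J: "finite J" "J \<noteq> {}" using ne by (auto simp: J_def)
  have F_ev: "Max ((\<lambda>z. cmod (poly q z)) ` lam ` J) = F (ev q)" for q
    by (simp add: F_def ev_def image_image)
  have "subspace W"
    unfolding subspace_def
  proof (intro conjI ballI allI)
    show "0 \<in> W"
      unfolding W_def ev_def by (intro image_eqI[of _ _ 0]) (auto simp: vec_eq_iff)
  next
    fix x y assume "x \<in> W" "y \<in> W"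
    then obtain p q where "x = ev p" "y = ev q" "degree p \<le> m" "degree q \<le> m"
      by (auto simp: W_def)
    then show "x + y \<in> W"
      unfolding W_def by (intro image_eqI[of _ _ "p + q"])
        (auto simp: ev_def vec_eq_iff degree_add_le)
  next
    fix c :: real and x assume "x \<in> W"
    then obtain p where "x = ev p" "degree p \<le> m"
      by (auto simp: W_def)
    then show "c *\<^sub>R x \<in> W"
      unfolding W_def by (intro image_eqI[of _ _ "smult (of_real c) p"])
        (auto simp: ev_def vec_eq_iff scaleR_conv_of_real[where 'a = complex])
  qed
  then have "closed W" by (rule closed_subspace)
  moreover have "closed {x::complex^'n. x $ i = 1 \<and> (\<forall>j. cmod (x $ j) \<le> 1)}"
    by (intro closed_Collect_conj closed_Collect_all closed_Collect_eq closed_Collect_le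
        continuous_intros)
  ultimately have "closed C" unfolding C_def by (rule closed_Int)
  moreover have "bounded C"
    unfolding bounded_iff
  proof (intro exI ballI)
    fix x assume "x \<in> C"
    then show "norm x \<le> norm (1 :: complex^'n)"
      by (intro norm_le_componentwise_cart) (auto simp: C_def)
  qed
  ultimately have "compact C" by (simp add: compact_eq_bounded_closed)
  have one: "ev 1 \<in> C"
    unfolding C_def W_def by (auto simp: ev_def intro!: image_eqI[of _ _ 1])
  have "continuous_on C F"
    unfolding F_def using J by (intro continuous_on_Max_image continuous_intros)
  with \<open>compact C\<close> one obtain x where x: "x \<in> C" "\<And>y. y \<in> C \<Longrightarrow> F x \<le> F y"
    using continuous_attains_inf[of C F] by blast
  then obtain q where q: "x = ev q" "degree q \<le> m" "poly q (lam i) = 1"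
    by (auto simp: C_def W_def ev_def)
  have "F x \<le> F (ev p)" if p: "p \<in> normalized_polys m (lam i)" for p
  proof (cases "F (ev p) \<le> 1")
    case True
    then have "cmod (ev p $ j) \<le> 1" if "j \<in> J" for j
      using J that by (simp add: F_def)
    moreover have "ev p $ i = 1" using p by (simp add: ev_def normalized_polys_def)
    ultimately have "cmod (ev p $ j) \<le> 1" for j
      by (cases "j = i") (auto simp: J_def)
    with p have "ev p \<in> C"
      by (auto simp: C_def W_def ev_def normalized_polys_def)
    then show ?thesis by (rule x(2))
  next
    case False
    have "F x \<le> F (ev 1)" using one by (rule x(2))
    also have "F (ev 1) = 1" using J by (simp add: F_def ev_def)
    finally show ?thesis using False by simp
  qed
  then show ?thesis
    using that[of q] q by (auto simp: F_ev J_def[symmetric] normalized_polys_def)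
qed

corollary gamma_min_attained:
  fixes lam :: "'n::finite \<Rightarrow> complex"
  assumes "UNIV - {i} \<noteq> {}"
  obtains q where "q \<in> normalized_polys (k - 1) (lam i)"
    and "\<And>j. j \<noteq> i \<Longrightarrow> cmod (poly q (lam j)) \<le> gamma_min lam i k"
proof -
  obtain q where q: "q \<in> normalized_polys (k - 1) (lam i)"
    "\<And>p. p \<in> normalized_polys (k - 1) (lam i) \<Longrightarrow>
      Max ((\<lambda>z. cmod (poly q z)) ` lam ` (UNIV - {i}))
        \<le> Max ((\<lambda>z. cmod (poly p z)) ` lam ` (UNIV - {i}))"
    using best_normalized_poly[OF assms] by blast
  then have "gamma_min lam i k = Max ((\<lambda>z. cmod (poly q z)) ` lam ` (UNIV - {i}))"
    unfolding gamma_min_def by (intro Least_equality) auto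
  then have "cmod (poly q (lam j)) \<le> gamma_min lam i k" if "j \<noteq> i" for j
    using that by (auto intro!: Max_ge)
  with q(1) that show thesis by blast
qed

section \<open>Quasi-optimality of the sketched projection\<close>

text \<open>
  The image of a subspace under the sketch is a subspace of a finite-dimensional space, hence
  closed, so it has a point nearest to the sketch of \<open>x\<close>. This makes the arg min a true minimiser.
\<close>

lemma sketched_proj_minimises:
  fixes \<Omega> :: "real ^ 'n ^ 'd"
  assumes "subspace K"
  shows "sketched_proj \<Omega> K x \<in> K"
    and "y \<in> K \<Longrightarrow> norm (\<Omega> *v (x - sketched_proj \<Omega> K x)) \<le> norm (\<Omega> *v (x - y))"
proof -
  have "subspace ((*v) \<Omega> ` K)"
    using assms by (intro linear_subspace_image) auto
  then have "closed ((*v) \<Omega> ` K)" by (rule closed_subspace)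
  moreover have "(*v) \<Omega> ` K \<noteq> {}" using subspace_0[OF assms] by auto
  ultimately obtain w where "w \<in> K"
    "\<And>y. y \<in> K \<Longrightarrow> dist (\<Omega> *v x) (\<Omega> *v w) \<le> dist (\<Omega> *v x) (\<Omega> *v y)"
    by (rule distance_attains_inf) auto
  then have w: "w \<in> K" "\<And>y. y \<in> K \<Longrightarrow> norm (\<Omega> *v (x - w)) \<le> norm (\<Omega> *v (x - y))"
    by (auto simp: dist_norm matrix_vector_mult_diff_distrib)
  have "sketched_proj \<Omega> K x \<in> K \<and>
      (\<forall>y\<in>K. norm (\<Omega> *v (x - sketched_proj \<Omega> K x)) \<le> norm (\<Omega> *v (x - y)))"
    unfolding sketched_proj_def arg_min_on_def
    by (rule arg_minI[of _ w]) (use w in \<open>auto simp: not_less\<close>)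
  then show "sketched_proj \<Omega> K x \<in> K"
    and "y \<in> K \<Longrightarrow> norm (\<Omega> *v (x - sketched_proj \<Omega> K x)) \<le> norm (\<Omega> *v (x - y))"
    by auto
qed

lemma sketched_proj_quasi_optimal:
  fixes \<Omega> :: "real ^ 'n ^ 'd"
  assumes K: "subspace K" and y: "y \<in> K"
    and emb: "eps_embedding \<Omega> \<epsilon> (span (K \<union> {x}))"
  shows "norm (x - sketched_proj \<Omega> K x) \<le> sqrt ((1 + \<epsilon>) / (1 - \<epsilon>)) * norm (x - y)"
proof -
  let ?p = "sketched_proj \<Omega> K x"
  have eps: "0 \<le> \<epsilon>" "\<epsilon> < 1" using emb by (auto simp: eps_embedding_def)
  have "?p \<in> K" using K by (rule sketched_proj_minimises)
  then have mem: "x - ?p \<in> span (K \<union> {x})" "x - y \<in> span (K \<union> {x})"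
    using y by (auto intro!: span_diff intro: span_base)
  have "(1 - \<epsilon>) * (norm (x - ?p))\<^sup>2 \<le> (norm (\<Omega> *v (x - ?p)))\<^sup>2"
    using emb mem by (simp add: eps_embedding_def)
  also have "\<dots> \<le> (norm (\<Omega> *v (x - y)))\<^sup>2"
    using sketched_proj_minimises(2)[OF K y] by (intro power_mono) auto
  also have "\<dots> \<le> (1 + \<epsilon>) * (norm (x - y))\<^sup>2"
    using emb mem by (simp add: eps_embedding_def)
  finally have "(norm (x - ?p))\<^sup>2 \<le> (1 + \<epsilon>) / (1 - \<epsilon>) * (norm (x - y))\<^sup>2"
    using eps by (simp add: field_simps)
  then have "norm (x - ?p) \<le> sqrt ((1 + \<epsilon>) / (1 - \<epsilon>) * (norm (x - y))\<^sup>2)"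
    by (rule real_le_rsqrt)
  then show ?thesis by (simp only: real_sqrt_mult real_sqrt_abs abs_norm_cancel)
qed

section \<open>Approximating an eigenvector from the Krylov space\<close>

lemma norm_vector_scalar_mult_complex:
  fixes x :: "complex ^ 'n"
  shows "norm (c *s x) = cmod c * norm x"
  by (simp add: norm_vec_def norm_mult L2_set_right_distrib)

lemma funpow_cmat_cvec:
  fixes A :: "real ^ 'n ^ 'n"
  shows "((*v) (cmat A) ^^ m) (cvec v) = cvec (((*v) A ^^ m) v)"
proof (induction m)
  case (Suc m)
  have "cmat A *v cvec x = cvec (A *v x)" for x
    by (simp add: cvec_def cmat_def matrix_vector_mult_def vec_eq_iff)
  then show ?case by (simp add: Suc)
qed simp

lemma funpow_matrix_eigen_sum:
  fixes B :: "complex ^ 'n ^ 'n"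
  assumes "\<And>j. j \<in> J \<Longrightarrow> B *v u j = lam j *s u j"
  shows "((*v) B ^^ m) (\<Sum>j\<in>J. \<alpha> j *s u j) = (\<Sum>j\<in>J. (\<alpha> j * lam j ^ m) *s u j)"
proof (induction m)
  case (Suc m)
  have "B *v (c *s u j) = (c * lam j) *s u j" if "j \<in> J" for j c
    using assms[OF that] by (simp add: vector_scalar_commute)
  then show ?case
    by (simp add: Suc linear_sum[OF matrix_vector_mul_linear] mult_ac)
qed auto

text \<open>
  Taking entrywise real parts does for the real Krylov space what complexifying it would:
  a complex combination of the real vectors \<open>A\<^sup>m v\<close> has as its real part the combination with the
  real parts of the coefficients.
\<close>

lemma Re_combination_in_krylov:
  "(\<chi> s. Re ((\<Sum>m<k. c m *s cvec (((*v) A ^^ m) v)) $ s)) \<in> krylov A v k"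
proof -
  have "(\<chi> s. Re ((\<Sum>m<k. c m *s cvec (((*v) A ^^ m) v)) $ s))
      = (\<Sum>m<k. Re (c m) *\<^sub>R ((*v) A ^^ m) v)"
    by (simp add: vec_eq_iff cvec_def)
  also have "\<dots> \<in> krylov A v k"
    unfolding krylov_def by (intro span_sum span_scale span_base) auto
  finally show ?thesis .
qed

text \<open>
  The vector \<open>x = q(A) v / \<alpha>\<^sub>i\<close> has eigencoefficients \<open>\<alpha>\<^sub>j q(\<lambda>\<^sub>j) / \<alpha>\<^sub>i\<close>, so the normalisation
  of \<open>q\<close> makes the coefficient of \<open>u\<^sub>i\<close> exactly 1 and \<open>x - u\<^sub>i\<close> contains only the other
  eigenvectors. Passing from \<open>x\<close> to its real part \<open>y\<close> cannot increase the error because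
  \<open>w - y\<close> is the real part of \<open>u\<^sub>i - x\<close>.
\<close>

lemma krylov_approximates_eigenvector:
  fixes A :: "real ^ 'n ^ 'n" and v w :: "real ^ 'n" and u :: "'j::finite \<Rightarrow> complex ^ 'n"
  assumes eig: "\<And>j. cmat A *v u j = lam j *s u j" and unit: "\<And>j. norm (u j) = 1"
    and w: "u i = cvec w" and v: "cvec v = (\<Sum>j\<in>UNIV. \<alpha> j *s u j)" and \<alpha>: "\<alpha> i \<noteq> 0"
    and k: "1 \<le> k" and q: "q \<in> normalized_polys (k - 1) (lam i)"
  obtains y where "y \<in> krylov A v k"
    and "norm (w - y) \<le> (\<Sum>j\<in>UNIV - {i}. cmod (\<alpha> j) / cmod (\<alpha> i) * cmod (poly q (lam j)))"
proof -
  define x where "x = (\<Sum>m<k. (coeff q m / \<alpha> i) *s cvec (((*v) A ^^ m) v))"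
  define y where "y = (\<chi> s. Re (x $ s))"
  have deg: "degree q < k" and q1: "poly q (lam i) = 1"
    using q k by (auto simp: normalized_polys_def)
  have q_sum: "poly q z = (\<Sum>m<k. coeff q m * z ^ m)" for z
    unfolding poly_altdef
    by (rule sum.mono_neutral_left) (use deg in \<open>auto simp: coeff_eq_0\<close>)
  have "x = (\<Sum>m<k. (coeff q m / \<alpha> i) *s (\<Sum>j\<in>UNIV. (\<alpha> j * lam j ^ m) *s u j))"
    unfolding x_def funpow_cmat_cvec[symmetric] v
    by (simp add: funpow_matrix_eigen_sum[where lam = lam] eig)
  also have "\<dots> = (\<Sum>j\<in>UNIV. (\<alpha> j / \<alpha> i * poly q (lam j)) *s u j)"
    unfolding q_sum vec.scale_sum_right
    by (subst sum.swap) (simp add: sum_distrib_left vec.scale_sum_left mult_ac)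
  also have "\<dots> = u i + (\<Sum>j\<in>UNIV - {i}. (\<alpha> j / \<alpha> i * poly q (lam j)) *s u j)"
    using \<alpha> q1 by (subst sum.remove[of _ i]) auto
  finally have x: "x - u i = (\<Sum>j\<in>UNIV - {i}. (\<alpha> j / \<alpha> i * poly q (lam j)) *s u j)"
    by simp
  have "norm (w - y) \<le> norm (x - u i)"
  proof (rule norm_le_componentwise_cart)
    fix s
    have "norm ((w - y) $ s) = \<bar>Re ((x - u i) $ s)\<bar>"
      by (simp add: w y_def cvec_def abs_minus_commute)
    then show "norm ((w - y) $ s) \<le> norm ((x - u i) $ s)"
      using abs_Re_le_cmod[of "(x - u i) $ s"] by simp
  qed
  also have "\<dots> \<le> (\<Sum>j\<in>UNIV - {i}. norm ((\<alpha> j / \<alpha> i * poly q (lam j)) *s u j))"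
    unfolding x by (rule norm_sum)
  also have "\<dots> = (\<Sum>j\<in>UNIV - {i}. cmod (\<alpha> j) / cmod (\<alpha> i) * cmod (poly q (lam j)))"
    by (simp add: norm_vector_scalar_mult_complex unit norm_mult norm_divide)
  finally have err:
    "norm (w - y) \<le> (\<Sum>j\<in>UNIV - {i}. cmod (\<alpha> j) / cmod (\<alpha> i) * cmod (poly q (lam j)))" .
  have "y \<in> krylov A v k"
    unfolding y_def x_def by (rule Re_combination_in_krylov)
  with err that show thesis by blast
qed

section \<open>The error bound\<close>

theorem proposition5p1:
  fixes A :: "real ^ 'n ^ 'n"
    and u :: "'n \<Rightarrow> complex ^ 'n"
    and lam :: "'n \<Rightarrow> complex"
    and i :: 'n
    and u\<^sub>i v\<^sub>1 :: "real ^ 'n"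
    and \<alpha> :: "'n \<Rightarrow> complex"
    and \<Omega> :: "real ^ 'n ^ 'd"
    and \<epsilon> :: real
    and k :: nat
  assumes "unit_eigenbasis A u lam"
    and "u i = cvec u\<^sub>i"
    and "cvec v\<^sub>1 = (\<Sum>j\<in>UNIV. \<alpha> j *s u j)"
    and "\<alpha> i \<noteq> 0"
    and "1 \<le> k"
    and "dim (krylov A v\<^sub>1 k) = k"
    and "eps_embedding \<Omega> \<epsilon> (span (krylov A v\<^sub>1 k \<union> {u\<^sub>i}))"
  shows "norm (u\<^sub>i - sketched_proj \<Omega> (krylov A v\<^sub>1 k) u\<^sub>i)
           \<le> sqrt ((1 + \<epsilon>) / (1 - \<epsilon>)) * xi \<alpha> i * gamma_min lam i k"
proof -
  let ?K = "krylov A v\<^sub>1 k" and ?c = "sqrt ((1 + \<epsilon>) / (1 - \<epsilon>))"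
  have c: "?c \<ge> 0" using assms(7) by (auto simp: eps_embedding_def)
  have bound: "norm (u\<^sub>i - sketched_proj \<Omega> ?K u\<^sub>i)
      \<le> ?c * (\<Sum>j\<in>UNIV - {i}. cmod (\<alpha> j) / cmod (\<alpha> i) * cmod (poly q (lam j)))"
    if q: "q \<in> normalized_polys (k - 1) (lam i)" for q
  proof -
    obtain y where y: "y \<in> ?K"
      "norm (u\<^sub>i - y) \<le> (\<Sum>j\<in>UNIV - {i}. cmod (\<alpha> j) / cmod (\<alpha> i) * cmod (poly q (lam j)))"
      by (rule krylov_approximates_eigenvector[of A u lam i u\<^sub>i v\<^sub>1 \<alpha> k q])
        (use assms(1-5) q in \<open>auto simp: unit_eigenbasis_def\<close>)
    have "norm (u\<^sub>i - sketched_proj \<Omega> ?K u\<^sub>i) \<le> ?c * norm (u\<^sub>i - y)"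
      using y(1) assms(7) by (intro sketched_proj_quasi_optimal) (auto simp: krylov_def)
    also have "\<dots> \<le> ?c * (\<Sum>j\<in>UNIV - {i}. cmod (\<alpha> j) / cmod (\<alpha> i) * cmod (poly q (lam j)))"
      using y(2) c by (rule mult_left_mono)
    finally show ?thesis .
  qed
  show ?thesis
  proof (cases "UNIV - {i} = {}")
    case True
    \<comment> \<open>In dimension one the remainder is an empty sum, so the constant polynomial already
      shows that the error vanishes; the maximum over no eigenvalues is unspecified.\<close>
    have "1 \<in> normalized_polys (k - 1) (lam i)"
      by (simp add: normalized_polys_def)
    from bound[OF this] True show ?thesis
      by (simp only: xi_def sum.empty mult_zero_left mult_zero_right)
  next
    case False
    then obtain q where q: "q \<in> normalized_polys (k - 1) (lam i)"
      "\<And>j. j \<noteq> i \<Longrightarrow> cmod (poly q (lam j)) \<le> gamma_min lam i k"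
      using gamma_min_attained by blast
    have "(\<Sum>j\<in>UNIV - {i}. cmod (\<alpha> j) / cmod (\<alpha> i) * cmod (poly q (lam j)))
        \<le> xi \<alpha> i * gamma_min lam i k"
      unfolding xi_def sum_distrib_right
      by (intro sum_mono mult_left_mono) (auto intro: q(2))
    then have "?c * (\<Sum>j\<in>UNIV - {i}. cmod (\<alpha> j) / cmod (\<alpha> i) * cmod (poly q (lam j)))
        \<le> ?c * (xi \<alpha> i * gamma_min lam i k)"
      using c by (rule mult_left_mono)
    with bound[OF q(1)] show ?thesis by (simp only: mult.assoc)
  qed
qed

end
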